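(* Let $d$ and $m$ be positive integers. Then $\phi_{d,m}(\mathcal{D}_{d,m}) \subseteq \mathrm{Mat}^+_{d,d+m}(\mathbb{R})$; that is, for every $d\times m$ rational Dyck matrix $D$, the $d \times (d+m)$ matrix $\phi_{d,m}(D)$ has full rank and all its maximal ($d\times d$) minors are nonnegative.
   Context: A rational Dyck path of type $(m,d)$ is a lattice path from $(0,0)$ to $(m,d)$ that only uses unit steps $(1,0)$ or $(0,1)$ and never goes above the line $y=(d/m)x$. A $d\times m$ binary matrix $(a_{i,j})$ (entries in $\{0,1\}$) is a rational Dyck matrix if its zero entries are separated from its one entries by a vertically-reflected rational Dyck path of type $(m,d)$, with the zeros in the upper-right corner; explicitly, there is a rational Dyck path of type $(m,d)$ such that, if $h_j$ is the height ($y$-coordinate) of its $j$-th horizontal step from the left, then $a_{i,j}=0$ if and only if $i\le h_j$. $\mathcal{D}_{d,m}$ denotes the set of all $d\times m$ rational Dyck matrices. The map $\phi_{d,m}\colon \mathrm{Mat}_{d,m}(\mathbb{R})\to \mathrm{Mat}_{d,d+m}(\mathbb{R})$ sends $A=(a_{i,j})$ to the block matrix $(I_d \mid A')$, where $I_d$ is the identity matrix and $A'$ is the $d\times m$ matrix with $(i,j)$ entry $(-1)^{d-i}a_{d+1-i,j}$. $\mathrm{Mat}^+_{d,n}(\mathbb{R})$ is the set of full-rank (rank $d$) real $d\times n$ matrices all of whose maximal minors are nonnegative. *)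

theory Defs
  imports
    "Jordan_Normal_Form.Determinant"
    "Jordan_Normal_Form.DL_Rank"
    "Jordan_Normal_Form.DL_Submatrix"
begin

text \<open>A lattice path starting at the origin is given by its word of unit steps.\<close>

datatype lattice_step = East | North

definition endpoint :: "lattice_step list \<Rightarrow> nat \<times> nat" where
  "endpoint w = (count_list w East, count_list w North)"

text \<open>The vertices of a path are the endpoints of its prefixes. Since a half-plane is convex,
  the path stays weakly below the line \<open>y = (d/m) x\<close> iff all of its vertices do.\<close>

definition rational_dyck_path :: "nat \<Rightarrow> nat \<Rightarrow> lattice_step list \<Rightarrow> bool" where
  "rational_dyck_path m d w \<longleftrightarrow>
     endpoint w = (m, d) \<and>
     (\<forall>k\<le>length w. \<forall>x y. endpoint (take k w) = (x, y) \<longrightarrow>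
        real y \<le> (real d / real m) * real x)"

text \<open>The heights of the horizontal steps, from left to right, of the path with steps \<open>w\<close>
  that starts at height \<open>h\<close>.\<close>

fun horizontal_heights :: "nat \<Rightarrow> lattice_step list \<Rightarrow> nat list" where
  "horizontal_heights h [] = []"
| "horizontal_heights h (East # w) = h # horizontal_heights h w"
| "horizontal_heights h (North # w) = horizontal_heights (Suc h) w"

text \<open>Matrix indices start at 0, so the condition \<open>i \<le> h\<^sub>j\<close> on 1-based row indices
  reads \<open>i < h\<^sub>j\<close> here.\<close>

definition rational_dyck_matrices :: "nat \<Rightarrow> nat \<Rightarrow> real mat set" where
  "rational_dyck_matrices d m =
     {A \<in> carrier_mat d m. elements_mat A \<subseteq> {0, 1} \<and>
        (\<exists>w. rational_dyck_path m d w \<and>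
           (\<forall>i<d. \<forall>j<m. A $$ (i, j) = 0 \<longleftrightarrow> i < horizontal_heights 0 w ! j))}"

text \<open>In 1-based indices the right block has entries \<open>(-1)\<^bsup>d-i\<^esup> a\<^bsub>d+1-i,j\<^esub>\<close>. The block matrix
  has empty lower blocks, as it consists of two blocks side by side.\<close>

definition dyck_phi :: "nat \<Rightarrow> nat \<Rightarrow> real mat \<Rightarrow> real mat" where
  "dyck_phi d m A =
     four_block_mat
       (1\<^sub>m d) (mat d m (\<lambda>(i, j). (-1) ^ (d - 1 - i) * A $$ (d - 1 - i, j)))
       (0\<^sub>m 0 d) (0\<^sub>m 0 m)"

definition Mat_plus :: "nat \<Rightarrow> nat \<Rightarrow> real mat set" where
  "Mat_plus d n =
     {A \<in> carrier_mat d n. vec_space.rank d A = d \<and>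
        (\<forall>J. J \<subseteq> {..<n} \<and> card J = d \<longrightarrow> 0 \<le> det (submatrix A UNIV J))}"

end

theory Submission
  imports Defs "Jordan_Normal_Form.DL_Rank_Submatrix"
begin

text \<open>
  Let \<open>h\<^sub>0 \<le> h\<^sub>1 \<le> \<dots>\<close> be the heights of the horizontal steps of the path. Column \<open>j\<close> of a
  Dyck matrix is 1 exactly in the rows \<open>i \<ge> h\<^sub>j\<close>, so after the reversal of the rows the ones fill an
  initial segment of length \<open>c\<^sub>j = d - h\<^sub>j\<close>, and these lengths decrease weakly from left to right:
  the support is a staircase. The columns of the image are therefore the unit vectors
  \<open>e\<^sub>0, \<dots>, e\<^bsub>d-1\<^esub>\<close>, followed by vectors \<open>v\<^sub>c = \<Sum>i<c. (-1)\<^bsup>d-1-i\<^esup> e\<^sub>i\<close> with weakly decreasing \<open>c\<close>.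

  The unit vectors alone give rank \<open>d\<close>. A maximal minor consists of \<open>k\<close> increasing unit vectors
  followed by \<open>d - k\<close> staircase columns, and \<open>staircase_det_nonneg\<close> shows by induction on the size that
  it is nonnegative. The induction expands along the last row. If two staircase columns reach the
  last row, they are equal and the determinant vanishes. Otherwise only the last unit vector and the
  first staircase column can be nonzero there; each of these two columns is next to the border between
  the blocks, so the sign of its cofactor is known, and deleting it leaves a smaller matrix of
  the same form, or one with a zero column if the unit vector of the last row stays. Truncation turns each remaining \<open>v\<^sub>c\<close> into the negative of a staircase column of the
  smaller size, which exactly cancels the cofactor sign.
\<close>

lemma det_zero_column:
  fixes A :: "'a::comm_ring_1 mat"
  assumes A: "A \<in> carrier_mat n n" and l: "l < n" and zero: "\<And>i. i < n \<Longrightarrow> A $$ (i, l) = 0"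
  shows "det A = 0"
  using laplace_expansion_column[OF A l] zero by simp

lemma mat_delete_last_row_index:
  assumes "A \<in> carrier_mat (Suc n) (Suc n)" and "l \<le> n" and "i < n" and "j < n"
  shows "mat_delete A n l $$ (i, j) = A $$ (i, if j < l then j else Suc j)"
  using mat_delete_index[of A n n l i j] assms by (auto simp: insert_index_def)

text \<open>
  The induction needs the scale \<open>t\<close> of the staircase columns, because deleting the last row replaces
  \<open>t\<close> by \<open>-t\<close>. The factor \<open>t ^ (n - k)\<close>, one \<open>t\<close> per staircase column, makes the claim independent of
  the sign of \<open>t\<close>; it also absorbs the cofactor signs. The lengths \<open>c j\<close> may exceed \<open>n\<close>, so
  that they can stay the same when a row is deleted. The same function \<open>p\<close> serves after the deletion,
  and since staircase columns always move one place to the left, \<open>c\<close> becomes \<open>\<lambda>j. c (Suc j)\<close>.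
\<close>

lemma staircase_det_nonneg:
  fixes A :: "'a::linordered_idom mat"
  assumes "A \<in> carrier_mat n n" and "k \<le> n"
    and "strict_mono_on {..<k} p" and "\<And>j. j < k \<Longrightarrow> p j < n"
    and "antimono_on {k..<n} c"
    and "\<And>i j. i < n \<Longrightarrow> j < k \<Longrightarrow> A $$ (i, j) = of_bool (i = p j)"
    and "\<And>i j. i < n \<Longrightarrow> k \<le> j \<Longrightarrow> j < n \<Longrightarrow>
           A $$ (i, j) = of_bool (i < c j) * (t * (-1) ^ (n - 1 - i))"
  shows "0 \<le> t ^ (n - k) * det A"
  using assms
proof (induction n arbitrary: A k p c t)
  case 0
  then show ?case by simp
next
  case (Suc n)
  note A = Suc.prems(1) and k = Suc.prems(2) and p_mono = Suc.prems(3) and p_less = Suc.prems(4)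
    and c_mono = Suc.prems(5) and unit = Suc.prems(6) and stair = Suc.prems(7)
  have del: "mat_delete A n l \<in> carrier_mat n n" for l
    using A by (simp add: mat_delete_def)
  have c_shift: "antimono_on {l..<n} (\<lambda>j. c (Suc j))" if "k \<le> Suc l" for l
    using c_mono that by (auto simp: monotone_on_def)
  have minor_unit: "mat_delete A n l $$ (i, j) = of_bool (i = p j)"
    if "i < n" "j < l" "j < k" "l \<le> n" for i j l
    using that k by (simp add: mat_delete_last_row_index[OF A] unit)
  have minor_stair:
    "mat_delete A n l $$ (i, j) = of_bool (i < c (Suc j)) * ((-t) * (-1) ^ (n - 1 - i))"
    if "i < n" "l \<le> j" "j < n" "k \<le> Suc l" for i j l
  proof -
    have "Suc n - 1 - i = Suc (n - 1 - i)" using that by simp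
    then have "t * (-1) ^ (Suc n - 1 - i) = (-t) * (-1) ^ (n - 1 - i)"
      by (simp only: power_Suc mult_minus_left mult_minus_right mult_1)
    then show ?thesis
      using that stair[of i "Suc j"] by (simp add: mat_delete_last_row_index[OF A])
  qed
  have sign: "(-t) ^ (n - l) = (-1) ^ (n + l) * t ^ (n - l)" if "l \<le> n" for l
  proof -
    have "even (n + l) \<longleftrightarrow> even (n - l)" using that by simp
    then have "(-1 :: 'a) ^ (n + l) = (-1) ^ (n - l)" by (simp only: minus_one_power_iff)
    then show ?thesis by (simp only: power_minus[of t])
  qed
  have last_unit: "l = k - 1" if l: "l < k" and pl: "p l = n" for l
  proof (rule ccontr)
    assume "l \<noteq> k - 1"
    then have "p l < p (k - 1)" and "p (k - 1) < Suc n"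
      using l p_less by (auto intro!: strict_mono_onD[OF p_mono])
    then show False using pl by simp
  qed
  show ?case
  proof (cases "Suc k < Suc n \<and> n < c (Suc k)")
    \<comment> \<open>Two staircase columns fill all rows and hence coincide.\<close>
    case True
    then have "n < c k"
      using monotone_onD[OF c_mono, of k "Suc k"] by simp
    then have "col A k = col A (Suc k)"
      using A True by (intro eq_vecI) (simp_all add: stair)
    then have "det A = 0"
      using det_identical_columns[OF A, of k "Suc k"] True by simp
    then show ?thesis by simp
  next
    case False
    have "0 \<le> t ^ (Suc n - k) * (A $$ (n, l) * cofactor A n l)" if l: "l < Suc n" for l
    proof (cases "A $$ (n, l) = 0")
      case nonzero: False
      consider "l < k" | "k \<le> l" by linarith
      then show ?thesis
      proof cases
        case 1
        then have pl: "p l = n"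
          using nonzero unit[of n l] by (simp split: if_splits)
        then have lk: "k = Suc l"
          using last_unit 1 by force
        have "0 \<le> (-t) ^ (n - l) * det (mat_delete A n l)"
        proof (rule Suc.IH[of _ l p "\<lambda>j. c (Suc j)"])
          show "strict_mono_on {..<l} p"
            using p_mono lk by (auto simp: monotone_on_def)
          show "p j < n" if "j < l" for j
            using that strict_mono_onD[OF p_mono, of j l] lk pl by auto
          show "antimono_on {l..<n} (\<lambda>j. c (Suc j))"
            using c_shift lk by simp
          show "mat_delete A n l $$ (i, j) = of_bool (i = p j)" if "i < n" "j < l" for i j
            using that l lk by (intro minor_unit) simp_all
          show "mat_delete A n l $$ (i, j) = of_bool (i < c (Suc j)) * ((-t) * (-1) ^ (n - 1 - i))"
            if "i < n" "l \<le> j" "j < n" for i j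
            using that lk by (intro minor_stair) simp_all
          show "l \<le> n" using l by simp
        qed (rule del)
        moreover have "t ^ (Suc n - k) * (A $$ (n, l) * cofactor A n l)
            = (-t) ^ (n - l) * det (mat_delete A n l)"
        proof -
          have "A $$ (n, l) = 1" using unit 1 pl by simp
          moreover have "Suc n - k = n - l" using lk by simp
          moreover have "l \<le> n" using l by simp
          ultimately show ?thesis by (simp only: cofactor_def sign mult_1 mult_ac)
        qed
        ultimately show ?thesis by simp
      next
        case 2
        then have cl: "n < c l"
          using nonzero stair[of n l] l by (simp split: if_splits)
        have lk: "l = k"
        proof (rule ccontr)
          assume "l \<noteq> k"
          then have "c l \<le> c (Suc k)" "Suc k < Suc n"
            using 2 l monotone_onD[OF c_mono, of "Suc k" l] by simp_all
          then show False using cl False by simp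
        qed
        have minor: "0 \<le> (-t) ^ (n - k) * det (mat_delete A n l)"
        proof (cases "\<exists>j<k. p j = n")
          \<comment> \<open>The unit vector of the deleted row is truncated to zero, so the minor lacks the form
            that the induction hypothesis asks for, but it vanishes.\<close>
          case True
          then obtain j where j: "j < k" "p j = n" by blast
          have "det (mat_delete A n l) = 0"
          proof (rule det_zero_column[OF del])
            show "j < n" using j l lk by simp
            show "mat_delete A n l $$ (i, j) = 0" if "i < n" for i
              using that j l lk by (subst minor_unit) simp_all
          qed
          then show ?thesis by simp
        next
          case no_unit: False
          show ?thesis
          proof (rule Suc.IH[of _ k p "\<lambda>j. c (Suc j)"])
            show "p j < n" if "j < k" for j
              using that no_unit p_less[OF that] by (auto simp: less_Suc_eq)
            show "antimono_on {k..<n} (\<lambda>j. c (Suc j))"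
              using c_shift by simp
            show "mat_delete A n l $$ (i, j) = of_bool (i = p j)" if "i < n" "j < k" for i j
              using that l lk by (intro minor_unit) simp_all
            show "mat_delete A n l $$ (i, j)
                = of_bool (i < c (Suc j)) * ((-t) * (-1) ^ (n - 1 - i))"
              if "i < n" "k \<le> j" "j < n" for i j
              using that lk by (intro minor_stair) simp_all
            show "k \<le> n" using l lk by simp
          qed (rule del p_mono)+
        qed
        have "t ^ (Suc n - k) * (A $$ (n, l) * cofactor A n l)
            = t\<^sup>2 * ((-t) ^ (n - k) * det (mat_delete A n l))"
        proof -
          have "A $$ (n, l) = t" using stair[of n l] 2 cl l by simp
          moreover have "Suc n - k = Suc (n - l)" and "n - k = n - l" and "l \<le> n"
            using l lk by simp_all
          ultimately show ?thesis
            by (simp only: cofactor_def sign power_Suc power2_eq_square mult_ac)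
        qed
        with minor show ?thesis by simp
      qed
    qed simp
    then have "0 \<le> (\<Sum>l<Suc n. t ^ (Suc n - k) * (A $$ (n, l) * cofactor A n l))"
      by (intro sum_nonneg) blast
    also have "\<dots> = t ^ (Suc n - k) * det A"
      unfolding laplace_expansion_row[OF A lessI] sum_distrib_left ..
    finally show ?thesis .
  qed
qed

lemma (in vec_space) rank_le_nr:
  assumes "A \<in> carrier_mat n nc"
  shows "rank A \<le> n"
proof -
  have cols: "set (cols A) \<subseteq> carrier_vec n"
    using cols_dim[of A] carrier_matD(1)[OF assms] by simp
  show ?thesis
    unfolding rank_def
    using subspace_dim[OF span_is_subspace[OF cols] fin_dim fin_dim_span_cols[OF assms]] dim_is_n
    by simp
qed

text \<open>The lower bound by the starting height makes the induction for sortedness go through.\<close>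

lemma sorted_horizontal_heights:
  "sorted (horizontal_heights h w) \<and> (\<forall>x\<in>set (horizontal_heights h w). h \<le> x)"
  by (induction h w rule: horizontal_heights.induct) (auto dest: Suc_leD)

lemma length_horizontal_heights: "length (horizontal_heights h w) = count_list w East"
  by (induction h w rule: horizontal_heights.induct) auto

lemma dyck_phi_carrier: "dyck_phi d m A \<in> carrier_mat d (d + m)"
  by (auto simp: dyck_phi_def intro!: carrier_matI)

lemma dyck_phi_index:
  assumes "i < d" and "j < d + m"
  shows "dyck_phi d m A $$ (i, j) =
    (if j < d then of_bool (i = j) else (-1) ^ (d - 1 - i) * A $$ (d - 1 - i, j - d))"
  using assms by (auto simp: dyck_phi_def)

lemma dyck_phi_rank: "vec_space.rank d (dyck_phi d m A) = d"
proof -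
  let ?M = "dyck_phi d m A"
  have rows: "{i. i < d \<and> i \<in> UNIV} = {..<d}" and cols: "{j. j < d + m \<and> j \<in> {..<d}} = {..<d}"
    by auto
  have pick: "pick {..<d} j = j" if "j < d" for j
  proof -
    have "{a \<in> {..<d}. a < j} = {..<j}" using that by auto
    then show ?thesis using pick_card_in_set[of j "{..<d}"] that by simp
  qed
  have "submatrix ?M UNIV {..<d} = 1\<^sub>m d"
    using dyck_phi_carrier[of d m A] rows cols
    by (intro eq_matI) (auto simp: submatrix_def pick pick_UNIV dyck_phi_index)
  then have "det (submatrix ?M UNIV {..<d}) \<noteq> 0" by simp
  from vec_space.rank_gt_minor[OF dyck_phi_carrier this]
  have "d \<le> vec_space.rank d ?M" unfolding cols by simp
  then show ?thesis
    using vec_space.rank_le_nr[OF dyck_phi_carrier[of d m A]] by simp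
qed

lemma dyck_phi_minor_nonneg:
  assumes D: "D \<in> rational_dyck_matrices d m" and J: "J \<subseteq> {..<d + m}" "card J = d"
  shows "0 \<le> det (submatrix (dyck_phi d m D) UNIV J)"
proof -
  obtain w where w: "rational_dyck_path m d w"
    and zero: "\<And>i j. i < d \<Longrightarrow> j < m \<Longrightarrow> D $$ (i, j) = 0 \<longleftrightarrow> i < horizontal_heights 0 w ! j"
    and D_carrier: "D \<in> carrier_mat d m" and D01: "elements_mat D \<subseteq> {0, 1}"
    using D unfolding rational_dyck_matrices_def by auto
  define h where "h = (\<lambda>j. horizontal_heights 0 w ! j)"
  have h_mono: "h i \<le> h j" if "i \<le> j" "j < m" for i j
    using that w sorted_horizontal_heights[of 0 w]
    by (auto simp: h_def rational_dyck_path_def endpoint_def length_horizontal_heights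
        intro!: sorted_nth_mono)
  have entry: "D $$ (i, j) = of_bool (h j \<le> i)" if "i < d" "j < m" for i j
  proof -
    have "D $$ (i, j) \<in> {0, 1}" using D01 elements_matI[OF D_carrier that refl] by blast
    then show ?thesis using zero[OF that] by (auto simp: h_def)
  qed
  define k where "k = card {j \<in> J. j < d}"
  have finJ: "finite J" using J(1) finite_subset by blast
  have pick_in: "pick J j \<in> J" and pick_less: "pick J j < d + m" if "j < d" for j
    using pick_in_set_le[of j J] that J by auto
  have pick_strict: "pick J i < pick J j" if "i < j" "j < d" for i j
    using that J by (intro pick_mono_le) auto
  have low: "pick J j < d" if "j < k" for j
    using that by (intro pick_le) (simp add: k_def conj_commute)
  have high: "d \<le> pick J j" if "k \<le> j" "j < d" for j
  proof (rule ccontr)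
    assume "\<not> d \<le> pick J j"
    then have "{a \<in> J. a < pick J j} \<subset> {j \<in> J. j < d}"
      using pick_in that by auto
    then have "card {a \<in> J. a < pick J j} < k"
      unfolding k_def using finJ by (intro psubset_card_mono) auto
    then show False using card_pick_le[of j J] that J by simp
  qed
  have k: "k \<le> d" unfolding k_def using J finJ card_mono[of J] by auto
  have cols: "{j. j < d + m \<and> j \<in> J} = J" using J by auto
  let ?S = "submatrix (dyck_phi d m D) UNIV J"
  have S: "?S \<in> carrier_mat d d"
    using dyck_phi_carrier[of d m D] J(2) by (intro carrier_matI) (simp_all add: dim_submatrix cols)
  have S_index: "?S $$ (i, j) = dyck_phi d m D $$ (i, pick J j)" if "i < d" "j < d" for i j
    using that dyck_phi_carrier[of d m D] J by (simp add: submatrix_index cols pick_UNIV)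
  \<comment> \<open>Scale \<open>t = 1\<close>; a height above \<open>d\<close> would give length 0 by truncated subtraction, which
    is again the correct support.\<close>
  have "0 \<le> 1 ^ (d - k) * det ?S"
  proof (rule staircase_det_nonneg[where p = "pick J" and c = "\<lambda>j. d - h (pick J j - d)"])
    show "strict_mono_on {..<k} (pick J)"
      using pick_strict k by (auto simp: strict_mono_on_def)
    show "antimono_on {k..<d} (\<lambda>j. d - h (pick J j - d))"
    proof (rule monotone_onI)
      fix i j assume ij: "i \<in> {k..<d}" "j \<in> {k..<d}" "i \<le> j"
      then have "pick J i \<le> pick J j"
        using pick_strict[of i j] by (cases "i = j") auto
      then have "h (pick J i - d) \<le> h (pick J j - d)"
        using pick_less[of j] high[of j] ij by (intro h_mono) auto
      then show "d - h (pick J i - d) \<ge> d - h (pick J j - d)" by simp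
    qed
    show "?S $$ (i, j) = of_bool (i = pick J j)" if "i < d" "j < k" for i j
      using that low k pick_less by (simp add: S_index dyck_phi_index)
    show "?S $$ (i, j) = of_bool (i < d - h (pick J j - d)) * (1 * (-1) ^ (d - 1 - i))"
      if "i < d" "k \<le> j" "j < d" for i j
      using that high[of j] pick_less[of j] by (auto simp: S_index dyck_phi_index entry)
  qed (use S k low in auto)
  then show ?thesis by simp
qed

theorem proposition2p5:
  fixes d m :: nat
  assumes "0 < d" and "0 < m"
  shows "dyck_phi d m ` rational_dyck_matrices d m \<subseteq> Mat_plus d (d + m)"
  using dyck_phi_carrier dyck_phi_rank dyck_phi_minor_nonneg by (auto simp: Mat_plus_def)

end
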